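(* Let $f:\mathbb{R}^d\to\mathbb{R}$ be differentiable and $s>0$. (1) For $n=0$, both the explicit Euler scheme EE$(m,n,q)$ and the semi-implicit Euler scheme SIE$(m,n,q)$ with step-size $\sqrt s$ reduce, in the position variable, to gradient descent $x_{k+1}=x_k-m\sqrt s\,\nabla f(x_k)$. (2) Let $m_{\mathrm{SIE}},n_{\mathrm{SIE}},q\ge 0$ with $n_{\mathrm{SIE}}\neq 0$, and set $$m_{\mathrm{EE}}=m_{\mathrm{SIE}}+\sqrt s\,n_{\mathrm{SIE}},\qquad n_{\mathrm{EE}}=(1-q\sqrt s)\,n_{\mathrm{SIE}}.$$ Then EE$(m_{\mathrm{EE}},n_{\mathrm{EE}},q)$ with step-size $\sqrt s$ and SIE$(m_{\mathrm{SIE}},n_{\mathrm{SIE}},q)$ with step-size $\sqrt s$ are the same algorithm in the position variable: after elimination of the velocity variable, the position iterates of both schemes satisfy one and the same recursion, for all $k\ge 1$, $$x_{k+1}=x_k+(1-q\sqrt s)(x_k-x_{k-1})-(m_{\mathrm{SIE}}\sqrt s+n_{\mathrm{SIE}}s)\nabla f(x_k)+(1-q\sqrt s)\,m_{\mathrm{SIE}}\sqrt s\,\nabla f(x_{k-1}).$$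
   Context: The generalized momentum ODE with parameters $(m,n,q)$ is $\dot X=-m\nabla f(X)-nV$, $\dot V=\nabla f(X)-qV$. Its discretizations with step-size $\sqrt s$ are, for $k\ge 0$ and $x_k,v_k\in\mathbb{R}^d$: EE$(m,n,q)$ (explicit Euler): $x_{k+1}-x_k=-m\sqrt s\nabla f(x_k)-n\sqrt s\,v_k$, $\ v_{k+1}-v_k=\sqrt s\nabla f(x_k)-q\sqrt s\,v_k$. SIE$(m,n,q)$ (semi-implicit Euler): $x_{k+1}-x_k=-m\sqrt s\nabla f(x_k)-n\sqrt s\,v_k$, $\ v_{k+1}-v_k=\sqrt s\nabla f(x_{k+1})-q\sqrt s\,v_k$. *)

theory Defs
  imports "HOL-Analysis.Analysis"
begin

definition grad :: "('a::euclidean_space \<Rightarrow> real) \<Rightarrow> 'a \<Rightarrow> 'a" where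
  "grad f x = (THE g. GDERIV f x :> g)"

lemma GDERIV_grad:
  assumes "f differentiable (at x)"
  shows "GDERIV f x :> grad f x"
proof -
  obtain L where L: "(f has_derivative L) (at x)"
    using assms by (auto simp: differentiable_def)
  have "L = (\<lambda>h. h \<bullet> adjoint L 1)"
    using adjoint_works[OF has_derivative_linear[OF L], of _ 1] by auto
  with L have ex: "GDERIV f x :> adjoint L 1"
    unfolding gderiv_def by metis
  have uniq: "g = g'" if "GDERIV f x :> g" "GDERIV f x :> g'" for g g'
  proof -
    have "(\<lambda>h. h \<bullet> g) = (\<lambda>h. h \<bullet> g')"
      using that unfolding gderiv_def by (rule has_derivative_unique)
    then have "\<forall>h. h \<bullet> g = h \<bullet> g'"
      by (rule fun_eq_iff[THEN iffD1])
    then show ?thesis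
      by (rule vector_eq_ldot[THEN iffD1])
  qed
  show ?thesis
    unfolding grad_def by (rule theI[where P = "\<lambda>g. GDERIV f x :> g", OF ex uniq[OF _ ex]])
qed

text \<open>In the schemes below, \<open>h\<close> is the step-size and \<open>x\<close>, \<open>v\<close> are the sequences of positions
  and velocities.\<close>

definition explicit_euler ::
  "('a::euclidean_space \<Rightarrow> real) \<Rightarrow> real \<Rightarrow> real \<Rightarrow> real \<Rightarrow> real \<Rightarrow> (nat \<Rightarrow> 'a) \<Rightarrow> (nat \<Rightarrow> 'a) \<Rightarrow> bool" where
  "explicit_euler f m n q h x v \<longleftrightarrow>
     (\<forall>k. x (k + 1) - x k = - ((m * h) *\<^sub>R grad f (x k)) - (n * h) *\<^sub>R v k \<and>
          v (k + 1) - v k = h *\<^sub>R grad f (x k) - (q * h) *\<^sub>R v k)"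

definition semi_implicit_euler ::
  "('a::euclidean_space \<Rightarrow> real) \<Rightarrow> real \<Rightarrow> real \<Rightarrow> real \<Rightarrow> real \<Rightarrow> (nat \<Rightarrow> 'a) \<Rightarrow> (nat \<Rightarrow> 'a) \<Rightarrow> bool" where
  "semi_implicit_euler f m n q h x v \<longleftrightarrow>
     (\<forall>k. x (k + 1) - x k = - ((m * h) *\<^sub>R grad f (x k)) - (n * h) *\<^sub>R v k \<and>
          v (k + 1) - v k = h *\<^sub>R grad f (x (k + 1)) - (q * h) *\<^sub>R v k)"

text \<open>Elimination of the velocity: the position sequences of a scheme, over all choices of
  the initial position and the initial velocity.\<close>

definition EE_positions ::
  "('a::euclidean_space \<Rightarrow> real) \<Rightarrow> real \<Rightarrow> real \<Rightarrow> real \<Rightarrow> real \<Rightarrow> (nat \<Rightarrow> 'a) set" where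
  "EE_positions f m n q h = {x. \<exists>v. explicit_euler f m n q h x v}"

definition SIE_positions ::
  "('a::euclidean_space \<Rightarrow> real) \<Rightarrow> real \<Rightarrow> real \<Rightarrow> real \<Rightarrow> real \<Rightarrow> (nat \<Rightarrow> 'a) set" where
  "SIE_positions f m n q h = {x. \<exists>v. semi_implicit_euler f m n q h x v}"

definition gradient_descent ::
  "('a::euclidean_space \<Rightarrow> real) \<Rightarrow> real \<Rightarrow> (nat \<Rightarrow> 'a) set" where
  "gradient_descent f \<eta> = {x. \<forall>k. x (k + 1) = x k - \<eta> *\<^sub>R grad f (x k)}"

definition two_step_recursion ::
  "('a::euclidean_space \<Rightarrow> real) \<Rightarrow> real \<Rightarrow> real \<Rightarrow> real \<Rightarrow> real \<Rightarrow> (nat \<Rightarrow> 'a) set" where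
  "two_step_recursion f m n q s = {x. \<forall>k\<ge>1.
     x (k + 1) = x k + (1 - q * sqrt s) *\<^sub>R (x k - x (k - 1))
                 - (m * sqrt s + n * s) *\<^sub>R grad f (x k)
                 + ((1 - q * sqrt s) * m * sqrt s) *\<^sub>R grad f (x (k - 1))}"

end

theory Submission
  imports Defs
begin

text \<open>Multiplying the velocity update by \<open>- n h\<close> and substituting
  \<open>- n h v\<^sub>k = x\<^sub>k\<^sub>+\<^sub>1 - x\<^sub>k + m h \<nabla>f(x\<^sub>k)\<close> from the position update gives a two-step recursion for
  the positions. This direction divides by nothing, so it survives \<open>n = 0\<close>; for \<open>n h \<noteq> 0\<close> the
  substitution conversely defines the velocity. The parameter change is chosen such that the
  gradient terms of the two schemes agree.\<close>

text \<open>The forcing \<open>w\<^sub>k\<close> is \<open>\<nabla>f(x\<^sub>k)\<close> for EE and \<open>\<nabla>f(x\<^sub>k\<^sub>+\<^sub>1)\<close> for SIE.\<close>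

lemma velocity_elimination:
  fixes x v g w :: "nat \<Rightarrow> 'a::real_vector"
  assumes x: "\<And>k. x (k + 1) - x k = - ((m * h) *\<^sub>R g k) - (n * h) *\<^sub>R v k"
    and v: "\<And>k. v (k + 1) - v k = h *\<^sub>R w k - (q * h) *\<^sub>R v k"
  shows "x (k + 2) - x (k + 1) + (m * h) *\<^sub>R g (k + 1)
    = (1 - q * h) *\<^sub>R (x (k + 1) - x k + (m * h) *\<^sub>R g k) - (n * h\<^sup>2) *\<^sub>R w k"
proof -
  have p: "x (j + 1) - x j + (m * h) *\<^sub>R g j = - ((n * h) *\<^sub>R v j)" for j
    using x[of j] by simp
  have v': "v (k + 1) = (1 - q * h) *\<^sub>R v k + h *\<^sub>R w k"
    using v[of k] by (simp add: algebra_simps)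
  have "- ((n * h) *\<^sub>R v (k + 1))
      = (1 - q * h) *\<^sub>R (- ((n * h) *\<^sub>R v k)) - (n * h\<^sup>2) *\<^sub>R w k"
    unfolding v' by (simp add: algebra_simps power2_eq_square)
  \<comment> \<open>\<open>p\<close>, read backwards at \<open>k + 1\<close> and at
    \<open>k\<close>, turns both velocity terms into positions; \<open>add.assoc\<close> merges
    \<open>k + 1 + 1\<close> into \<open>k + 2\<close>.\<close>
  then show ?thesis
    unfolding p[symmetric] by (simp add: add.assoc)
qed

lemma velocity_recovery:
  fixes x g w :: "nat \<Rightarrow> 'a::real_vector"
  assumes nz: "n * h \<noteq> 0"
    and rec: "\<And>k. x (k + 2) - x (k + 1) + (m * h) *\<^sub>R g (k + 1)
      = (1 - q * h) *\<^sub>R (x (k + 1) - x k + (m * h) *\<^sub>R g k) - (n * h\<^sup>2) *\<^sub>R w k"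
  shows "\<exists>v. \<forall>k. x (k + 1) - x k = - ((m * h) *\<^sub>R g k) - (n * h) *\<^sub>R v k \<and>
    v (k + 1) - v k = h *\<^sub>R w k - (q * h) *\<^sub>R v k"
proof -
  \<comment> \<open>The position update solved for the velocity.\<close>
  define v where "v k = (- 1 / (n * h)) *\<^sub>R (x (k + 1) - x k + (m * h) *\<^sub>R g k)" for k
  have p: "(n * h) *\<^sub>R v k = - (x (k + 1) - x k + (m * h) *\<^sub>R g k)" for k
    using nz by (simp add: v_def)
  \<comment> \<open>Scaled by \<open>n * h\<close>, velocities become position expressions through
    \<open>p\<close>, so that \<open>rec\<close> applies; \<open>nz\<close> then cancels the
    factor.\<close>
  have "(n * h) *\<^sub>R (v (k + 1) - v k) = (n * h) *\<^sub>R (h *\<^sub>R w k - (q * h) *\<^sub>R v k)" for k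
  proof -
    have "(n * h) *\<^sub>R v (k + 1) = (1 - q * h) *\<^sub>R ((n * h) *\<^sub>R v k) + (n * h\<^sup>2) *\<^sub>R w k"
      using rec[of k] unfolding p scaleR_minus_right by (simp add: algebra_simps)
    then show ?thesis
      by (simp add: algebra_simps power2_eq_square)
  qed
  then have "v (k + 1) - v k = h *\<^sub>R w k - (q * h) *\<^sub>R v k" for k
    using nz by (metis scaleR_left_imp_eq)
  moreover have "x (k + 1) - x k = - ((m * h) *\<^sub>R g k) - (n * h) *\<^sub>R v k" for k
    by (simp add: p)
  ultimately show ?thesis by blast
qed

text \<open>For \<open>n = 0\<close> the positions do not see the velocity, so a descent sequence
  needs only some solution of the velocity update. The initial value 0 is arbitrary.\<close>

lemma velocity_exists:
  fixes w :: "nat \<Rightarrow> 'a::real_vector"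
  shows "\<exists>v. \<forall>k. v (Suc k) = w k - c *\<^sub>R v k + v k"
  by (rule exI[of _ "rec_nat 0 (\<lambda>k u. w k - c *\<^sub>R u + u)"]) simp

lemma EE_positions_n_zero: "EE_positions f m 0 q h = gradient_descent f (m * h)"
  by (simp add: EE_positions_def gradient_descent_def explicit_euler_def all_conj_distrib
      velocity_exists diff_eq_eq)

lemma SIE_positions_n_zero: "SIE_positions f m 0 q h = gradient_descent f (m * h)"
  by (simp add: SIE_positions_def gradient_descent_def semi_implicit_euler_def all_conj_distrib
      velocity_exists diff_eq_eq)

text \<open>The index shift removes the truncated subtraction \<open>k - 1\<close>.\<close>

lemma two_step_recursion_iff:
  "x \<in> two_step_recursion f m n q s \<longleftrightarrow>
    (\<forall>k. x (k + 2) = x (k + 1) + (1 - q * sqrt s) *\<^sub>R (x (k + 1) - x k)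
      - (m * sqrt s + n * s) *\<^sub>R grad f (x (k + 1))
      + ((1 - q * sqrt s) * m * sqrt s) *\<^sub>R grad f (x k))"
proof -
  have "(\<forall>k\<ge>1. P k) \<longleftrightarrow> (\<forall>k. P (k + 1))" for P :: "nat \<Rightarrow> bool"
    by (metis Suc_eq_plus1 Suc_le_D One_nat_def le_add2)
  then show ?thesis
    by (simp add: two_step_recursion_def)
qed

text \<open>The forcing sits at the new position, so its \<open>n * s\<close> joins
  \<open>m * sqrt s\<close> in the coefficient of the newer gradient.\<close>

lemma two_step_recursion_iff_SIE:
  assumes "s \<ge> 0"
  shows "x \<in> two_step_recursion f m n q s \<longleftrightarrow>
    (\<forall>k. x (k + 2) - x (k + 1) + (m * sqrt s) *\<^sub>R grad f (x (k + 1))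
      = (1 - q * sqrt s) *\<^sub>R (x (k + 1) - x k + (m * sqrt s) *\<^sub>R grad f (x k))
        - (n * (sqrt s)\<^sup>2) *\<^sub>R grad f (x (k + 1)))"
proof -
  have lhs: "(a - b + c = d) \<longleftrightarrow> (a = b + d - c)" for a b c d :: 'a
    by (auto simp: algebra_simps)
  show ?thesis
    unfolding two_step_recursion_iff real_sqrt_pow2[OF assms] lhs
    by (simp add: algebra_simps)
qed

text \<open>The forcing sits at the old position. With \<open>h = sqrt s\<close>, the older gradient
  gets \<open>(1 - q * h) * (m + h * n) * h - (1 - q * h) * n * h * h = (1 - q * h) * m * h\<close>,
  which explains the choice of both EE parameters.\<close>

lemma two_step_recursion_iff_EE:
  assumes "s \<ge> 0"
  shows "x \<in> two_step_recursion f m n q s \<longleftrightarrow>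
    (\<forall>k. x (k + 2) - x (k + 1) + ((m + sqrt s * n) * sqrt s) *\<^sub>R grad f (x (k + 1))
      = (1 - q * sqrt s) *\<^sub>R (x (k + 1) - x k + ((m + sqrt s * n) * sqrt s) *\<^sub>R grad f (x k))
        - ((1 - q * sqrt s) * n * (sqrt s)\<^sup>2) *\<^sub>R grad f (x k))"
proof -
  have m: "(m + sqrt s * n) * sqrt s = m * sqrt s + n * s"
    using assms by (simp add: algebra_simps)
  have lhs: "(a - b + c = d) \<longleftrightarrow> (a = b + d - c)" for a b c d :: 'a
    by (auto simp: algebra_simps)
  show ?thesis
    unfolding two_step_recursion_iff real_sqrt_pow2[OF assms] m lhs
    by (simp add: algebra_simps)
qed

text \<open>Only elimination is used, so the case \<open>q * sqrt s = 1\<close> is covered.\<close>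

lemma EE_positions_subset:
  assumes "s \<ge> 0"
  shows "EE_positions f (m + sqrt s * n) ((1 - q * sqrt s) * n) q (sqrt s)
    \<subseteq> two_step_recursion f m n q s"
proof
  fix x assume "x \<in> EE_positions f (m + sqrt s * n) ((1 - q * sqrt s) * n) q (sqrt s)"
  then obtain v where "explicit_euler f (m + sqrt s * n) ((1 - q * sqrt s) * n) q (sqrt s) x v"
    by (auto simp: EE_positions_def)
  then show "x \<in> two_step_recursion f m n q s"
    unfolding two_step_recursion_iff_EE[OF assms] explicit_euler_def
    by (intro allI velocity_elimination[where g = "\<lambda>k. grad f (x k)" and w = "\<lambda>k. grad f (x k)"
          and v = v]) blast+
qed

lemma EE_positions_eq:
  assumes "s > 0" and "n \<noteq> 0" and "q * sqrt s \<noteq> 1"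
  shows "EE_positions f (m + sqrt s * n) ((1 - q * sqrt s) * n) q (sqrt s)
    = two_step_recursion f m n q s"
proof
  show "EE_positions f (m + sqrt s * n) ((1 - q * sqrt s) * n) q (sqrt s)
      \<subseteq> two_step_recursion f m n q s"
    using assms by (intro EE_positions_subset) simp
  show "two_step_recursion f m n q s
      \<subseteq> EE_positions f (m + sqrt s * n) ((1 - q * sqrt s) * n) q (sqrt s)"
  proof
    fix x assume "x \<in> two_step_recursion f m n q s"
    then show "x \<in> EE_positions f (m + sqrt s * n) ((1 - q * sqrt s) * n) q (sqrt s)"
      unfolding two_step_recursion_iff_EE[OF less_imp_le[OF assms(1)]]
        EE_positions_def explicit_euler_def mem_Collect_eq
      \<comment> \<open>The three assumptions make the EE coefficient
        \<open>(1 - q * sqrt s) * n * sqrt s\<close> nonzero, as recovery requires.\<close>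
      using assms
      by (intro velocity_recovery[where g = "\<lambda>k. grad f (x k)" and w = "\<lambda>k. grad f (x k)"]) auto
  qed
qed

lemma SIE_positions_eq:
  assumes "s > 0" and "n \<noteq> 0"
  shows "SIE_positions f m n q (sqrt s) = two_step_recursion f m n q s"
proof (intro set_eqI iffI)
  fix x assume "x \<in> SIE_positions f m n q (sqrt s)"
  then obtain v where "semi_implicit_euler f m n q (sqrt s) x v"
    by (auto simp: SIE_positions_def)
  then show "x \<in> two_step_recursion f m n q s"
    unfolding two_step_recursion_iff_SIE[OF less_imp_le[OF assms(1)]] semi_implicit_euler_def
    by (intro allI velocity_elimination[where g = "\<lambda>k. grad f (x k)"
          and w = "\<lambda>k. grad f (x (k + 1))" and v = v]) blast+
next
  fix x assume "x \<in> two_step_recursion f m n q s"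
  then show "x \<in> SIE_positions f m n q (sqrt s)"
    unfolding two_step_recursion_iff_SIE[OF less_imp_le[OF assms(1)]]
      SIE_positions_def semi_implicit_euler_def mem_Collect_eq
    using assms
    by (intro velocity_recovery[where g = "\<lambda>k. grad f (x k)" and w = "\<lambda>k. grad f (x (k + 1))"]) auto
qed

text \<open>If \<open>q * sqrt s = 1\<close>, then \<open>n_EE = 0\<close> and EE is gradient
  descent from the first step on, whereas the recursion leaves \<open>x 1\<close> free. Hence EE
  gets only an inclusion there.\<close>

theorem lemma2:
  fixes f :: "real ^ 'd \<Rightarrow> real" and s :: real
  assumes "\<And>x. f differentiable (at x)" and "s > 0"
  shows
    "(\<forall>m q :: real.
        EE_positions f m 0 q (sqrt s) = gradient_descent f (m * sqrt s) \<and>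
        SIE_positions f m 0 q (sqrt s) = gradient_descent f (m * sqrt s)) \<and>
     (\<forall>m_SIE n_SIE q m_EE n_EE :: real.
        m_SIE \<ge> 0 \<longrightarrow> n_SIE \<ge> 0 \<longrightarrow> q \<ge> 0 \<longrightarrow> n_SIE \<noteq> 0 \<longrightarrow>
        m_EE = m_SIE + sqrt s * n_SIE \<longrightarrow>
        n_EE = (1 - q * sqrt s) * n_SIE \<longrightarrow>
          EE_positions f m_EE n_EE q (sqrt s) \<subseteq> two_step_recursion f m_SIE n_SIE q s \<and>
          SIE_positions f m_SIE n_SIE q (sqrt s) = two_step_recursion f m_SIE n_SIE q s \<and>
          (q * sqrt s \<noteq> 1 \<longrightarrow>
             EE_positions f m_EE n_EE q (sqrt s) = SIE_positions f m_SIE n_SIE q (sqrt s)))"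
  using assms(2)
  by (auto simp: EE_positions_n_zero SIE_positions_n_zero EE_positions_eq SIE_positions_eq
      dest: subsetD[OF EE_positions_subset[OF less_imp_le]])

end
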